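(* Let $K$ be a field and let $L$ be a Galois extension field of degree $3$ over $K$, with cyclic Galois group generated by $\sigma$. For $a\in K$ and $b\in L$ with $b+\sigma(b)+\sigma^2(b)=0$, let $T_{a,b}:L\to L$ be the $K$-linear endomorphism $T_{a,b}(z)=a(\sigma^2(z)-\sigma(z))+bz$. Then the set $\mathcal{N}$ of all such $T_{a,b}$ is a three-dimensional $K$-subspace of the space of $K$-linear endomorphisms of $L$. The only elements of $\mathcal{N}$ that are not invertible are the $K$-multiples of $\sigma^2-\sigma$. Thus the non-invertible elements of $\mathcal{N}$ form a one-dimensional subspace, whose non-zero elements have rank $2$.
   Context: $L$ is regarded as a $3$-dimensional vector space over $K$, and $\sigma$ as a $K$-linear endomorphism of $L$. *)

theory Defs
  imports
    Complex_Main
    "HOL-Library.Function_Algebras"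
    "HOL-Computational_Algebra.Polynomial"
    "HOL-Algebra.Generated_Groups"
begin

text \<open>A field extension is given by an embedding \<open>\<iota>\<close> of the base field \<open>'k\<close> into the
  extension field \<open>'l\<close>.\<close>

locale field_extension =
  fixes \<iota> :: "'k::field \<Rightarrow> 'l::field"
  assumes emb_add: "\<iota> (c + d) = \<iota> c + \<iota> d"
    and emb_mult: "\<iota> (c * d) = \<iota> c * \<iota> d"
    and emb_one: "\<iota> 1 = 1"

definition ext_scale :: "('k::field \<Rightarrow> 'l::field) \<Rightarrow> 'k \<Rightarrow> 'l \<Rightarrow> 'l"
  where "ext_scale \<iota> c z = \<iota> c * z"

definition map_scale :: "('k::field \<Rightarrow> 'l::field) \<Rightarrow> 'k \<Rightarrow> ('l \<Rightarrow> 'l) \<Rightarrow> ('l \<Rightarrow> 'l)"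
  where "map_scale \<iota> c f = (\<lambda>z. ext_scale \<iota> c (f z))"

lemma (in field_extension) vector_space_ext_scale: "vector_space (ext_scale \<iota>)"
  by unfold_locales (simp_all add: ext_scale_def emb_add emb_mult emb_one algebra_simps)

lemma (in field_extension) vector_space_map_scale: "vector_space (map_scale \<iota>)"
  by unfold_locales
    (simp_all add: map_scale_def ext_scale_def emb_add emb_mult emb_one algebra_simps fun_eq_iff)

text \<open>\<open>dim\<close> is \<open>0\<close> on infinite-dimensional spaces, so a nonzero value of the degree says that
  the extension is finite of that degree.\<close>

definition ext_degree :: "('k::field \<Rightarrow> 'l::field) \<Rightarrow> nat"
  where "ext_degree \<iota> = vector_space.dim (ext_scale \<iota>) UNIV"

definition galois_group :: "('k::field \<Rightarrow> 'l::field) \<Rightarrow> ('l \<Rightarrow> 'l) monoid"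
  where "galois_group \<iota> =
    \<lparr>carrier = {\<tau>. bij \<tau> \<and> (\<forall>x y. \<tau> (x + y) = \<tau> x + \<tau> y) \<and>
                   (\<forall>x y. \<tau> (x * y) = \<tau> x * \<tau> y) \<and> (\<forall>c. \<tau> (\<iota> c) = \<iota> c)},
     mult = (\<circ>), one = id\<rparr>"

lemma group_galois_group: "group (galois_group \<iota>)"
proof (rule groupI)
  fix \<tau> assume "\<tau> \<in> carrier (galois_group \<iota>)"
  then have b: "bij \<tau>" and h: "\<And>x y. \<tau> (x + y) = \<tau> x + \<tau> y" "\<And>x y. \<tau> (x * y) = \<tau> x * \<tau> y"
    "\<And>c. \<tau> (\<iota> c) = \<iota> c"
    by (auto simp: galois_group_def)
  have i: "inv_into UNIV \<tau> z = w \<longleftrightarrow> z = \<tau> w" for z w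
    using b by (metis bij_inv_eq_iff)
  have s: "\<tau> (inv_into UNIV \<tau> z) = z" for z
    using i by metis
  have "inv_into UNIV \<tau> \<in> carrier (galois_group \<iota>)"
    by (simp add: galois_group_def b bij_imp_bij_inv i h s)
  moreover have "inv_into UNIV \<tau> \<otimes>\<^bsub>galois_group \<iota>\<^esub> \<tau> = \<one>\<^bsub>galois_group \<iota>\<^esub>"
    using b by (simp add: galois_group_def bij_is_inj)
  ultimately show "\<exists>\<rho>\<in>carrier (galois_group \<iota>). \<rho> \<otimes>\<^bsub>galois_group \<iota>\<^esub> \<tau> = \<one>\<^bsub>galois_group \<iota>\<^esub>"
    by blast
qed (auto simp: galois_group_def bij_comp o_assoc)

text \<open>Galois in the sense of Artin: algebraic, and the fixed field of the automorphism group
  is the base field.\<close>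

definition galois_extension :: "('k::field \<Rightarrow> 'l::field) \<Rightarrow> bool"
  where "galois_extension \<iota> \<longleftrightarrow> field_extension \<iota> \<and>
    (\<forall>z. \<exists>p. p \<noteq> 0 \<and> poly (map_poly \<iota> p) z = 0) \<and>
    {z. \<forall>\<tau>\<in>carrier (galois_group \<iota>). \<tau> z = z} = range \<iota>"

definition endomorphisms :: "('k::field \<Rightarrow> 'l::field) \<Rightarrow> ('l \<Rightarrow> 'l) set"
  where "endomorphisms \<iota> = {f. Vector_Spaces.linear (ext_scale \<iota>) (ext_scale \<iota>) f}"

definition invertible_endo :: "('k::field \<Rightarrow> 'l::field) \<Rightarrow> ('l \<Rightarrow> 'l) \<Rightarrow> bool"
  where "invertible_endo \<iota> f \<longleftrightarrow> (\<exists>g\<in>endomorphisms \<iota>. g \<circ> f = id \<and> f \<circ> g = id)"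

definition endo_rank :: "('k::field \<Rightarrow> 'l::field) \<Rightarrow> ('l \<Rightarrow> 'l) \<Rightarrow> nat"
  where "endo_rank \<iota> f = vector_space.dim (ext_scale \<iota>) (range f)"

definition T_map :: "('k::field \<Rightarrow> 'l::field) \<Rightarrow> ('l \<Rightarrow> 'l) \<Rightarrow> 'k \<Rightarrow> 'l \<Rightarrow> 'l \<Rightarrow> 'l"
  where "T_map \<iota> \<sigma> a b = (\<lambda>z. ext_scale \<iota> a ((\<sigma> ^^ 2) z - \<sigma> z) + b * z)"

definition N_space :: "('k::field \<Rightarrow> 'l::field) \<Rightarrow> ('l \<Rightarrow> 'l) \<Rightarrow> ('l \<Rightarrow> 'l) set"
  where "N_space \<iota> \<sigma> = {T_map \<iota> \<sigma> a b |a b. b + \<sigma> b + (\<sigma> ^^ 2) b = 0}"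

definition N_singular :: "('k::field \<Rightarrow> 'l::field) \<Rightarrow> ('l \<Rightarrow> 'l) \<Rightarrow> ('l \<Rightarrow> 'l) set"
  where "N_singular \<iota> \<sigma> = {f \<in> N_space \<iota> \<sigma>. \<not> invertible_endo \<iota> f}"

end

theory Submission
  imports Defs
begin

text \<open>Counting dimensions against \<open>[L : K] = 3\<close> shows that no element outside \<open>K\<close> is fixed by
  \<open>\<sigma>\<^sup>2\<close>, and then that \<open>\<sigma>\<^sup>3 = 1\<close>, since otherwise an element and its first three conjugates would
  be four distinct roots of a polynomial of degree at most three over \<open>K\<close>. The trace does not
  vanish identically, so by the additive form of Hilbert 90 its kernel is the range of \<open>\<sigma> - 1\<close>,
  which has dimension two. If \<open>T\<^bsub>a,b\<^esub> z = 0\<close> with \<open>z \<noteq> 0\<close>, then \<open>b = - a (\<sigma>\<^sup>2 z - \<sigma> z) / z\<close>, and the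
  trace of this quotient is, up to sign, the Vandermonde product of the conjugates of \<open>z\<close> divided
  by their product. As the trace of \<open>b\<close> is zero, \<open>a = 0\<close> or \<open>z \<in> K\<close>, and in both cases \<open>b = 0\<close>.\<close>

section \<open>Spans and independence of a few explicit vectors\<close>

context vector_space
begin

lemma in_span_pair: "x \<in> span {u, v} \<longleftrightarrow> (\<exists>a b. x = a *s u + b *s v)"
  by (simp add: span_breakdown_eq algebra_simps)

lemma in_span_triple: "x \<in> span {u, v, w} \<longleftrightarrow> (\<exists>a b c. x = a *s u + b *s v + c *s w)"
  by (simp add: span_breakdown_eq algebra_simps)

text \<open>Distinctness has to be recorded as well: independence is a property of sets, so
  \<open>{u, v}\<close> with \<open>u = v\<close> nonzero is independent but counts only once
  towards a dimension.\<close>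

lemma independent_pairI:
  assumes "\<And>a b. a *s u + b *s v = 0 \<Longrightarrow> a = 0 \<and> b = 0"
  shows "independent {u, v}" "u \<noteq> v"
proof -
  have "u \<notin> span {v}"
  proof
    assume "u \<in> span {v}"
    then obtain k where "u = k *s v" by (auto simp: span_singleton)
    then show False using assms[of 1 "- k"] by simp
  qed
  moreover have "v \<noteq> 0" using assms[of 0 1] by auto
  ultimately show "independent {u, v}" "u \<noteq> v"
    using independent_insertI[of u "{v}"] by (auto intro: span_base)
qed

lemma independent_tripleI:
  assumes "\<And>a b c. a *s u + b *s v + c *s w = 0 \<Longrightarrow> a = 0 \<and> b = 0 \<and> c = 0"
  shows "independent {u, v, w}" "card {u, v, w} = 3"
proof -
  have "u \<notin> span {v, w}"
  proof
    assume "u \<in> span {v, w}"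
    then obtain b c where "u = b *s v + c *s w" by (auto simp: in_span_pair)
    then show False using assms[of 1 "- b" "- c"] by simp
  qed
  moreover have "independent {v, w}" "v \<noteq> w"
    using independent_pairI[of v w] assms[of 0] by auto
  moreover have "u \<notin> {v, w}" using \<open>u \<notin> span {v, w}\<close> by (blast intro: span_base)
  ultimately show "independent {u, v, w}" "card {u, v, w} = 3"
    using independent_insertI[of u "{v, w}"] by auto
qed

lemma independent_quadrupleI:
  assumes "\<And>a b c d. a *s u + b *s v + c *s w + d *s x = 0 \<Longrightarrow> a = 0 \<and> b = 0 \<and> c = 0 \<and> d = 0"
  shows "independent {u, v, w, x}" "card {u, v, w, x} = 4"
proof -
  have "u \<notin> span {v, w, x}"
  proof
    assume "u \<in> span {v, w, x}"
    then obtain b c d where "u = b *s v + c *s w + d *s x" by (auto simp: in_span_triple)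
    then show False using assms[of 1 "- b" "- c" "- d"] by simp
  qed
  moreover have "independent {v, w, x}" "card {v, w, x} = 3"
    using independent_tripleI[of v w x] assms[of 0] by auto
  moreover have "u \<notin> {v, w, x}" using \<open>u \<notin> span {v, w, x}\<close> by (blast intro: span_base)
  ultimately show "independent {u, v, w, x}" "card {u, v, w, x} = 4"
    using independent_insertI[of u "{v, w, x}"] by simp_all
qed

end

text \<open>Of the Galois hypotheses only the fixed field of \<sigma> and the degree are kept. That
  \<sigma> has order three is derived from these in \<open>cube\<close>.\<close>

locale cyclic_cubic = field_extension \<iota>
  for \<iota> :: "'k::field \<Rightarrow> 'l::field" +
  fixes \<sigma> :: "'l \<Rightarrow> 'l"
  assumes bij: "bij \<sigma>"
    and add [simp]: "\<sigma> (x + y) = \<sigma> x + \<sigma> y"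
    and mult [simp]: "\<sigma> (x * y) = \<sigma> x * \<sigma> y"
    and fixes_base [simp]: "\<sigma> (\<iota> c) = \<iota> c"
    and fixed_in_base: "\<sigma> z = z \<Longrightarrow> z \<in> range \<iota>"
    and degree: "ext_degree \<iota> = 3"
begin

sublocale L: vector_space "ext_scale \<iota>"
  by (rule vector_space_ext_scale)

sublocale F: vector_space "map_scale \<iota>"
  by (rule vector_space_map_scale)

section \<open>Arithmetic of the embedding and of the automorphism\<close>

lemma emb_zero [simp]: "\<iota> 0 = 0"
  using emb_add[of 0 0] by (simp only: add_0_left add_cancel_right_right)

lemma emb_minus: "\<iota> (- c) = - \<iota> c"
  by (metis add.right_inverse add_eq_0_iff emb_add emb_zero)

lemma emb_eq_0 [simp]: "\<iota> c = 0 \<longleftrightarrow> c = 0"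
proof
  assume "\<iota> c = 0"
  show "c = 0"
  proof (rule ccontr)
    assume "c \<noteq> 0"
    then show False
      using emb_mult[of c "inverse c"] \<open>\<iota> c = 0\<close> by (simp add: emb_one)
  qed
qed simp

lemma zero [simp]: "\<sigma> 0 = 0"
  using fixes_base[of 0] by simp

lemma one [simp]: "\<sigma> 1 = 1"
  using fixes_base[of 1] by (simp add: emb_one)

lemma minus [simp]: "\<sigma> (- x) = - \<sigma> x"
  by (metis add.right_inverse add_eq_0_iff add zero)

lemma diff [simp]: "\<sigma> (x - y) = \<sigma> x - \<sigma> y"
  using add[of x "- y"] by simp

lemma inj_iff [simp]: "\<sigma> x = \<sigma> y \<longleftrightarrow> x = y"
  using bij_is_inj[OF bij] by (simp add: inj_eq)

lemma inverse [simp]: "\<sigma> (inverse x) = inverse (\<sigma> x)"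
proof (cases "x = 0")
  case False
  then have "\<sigma> (inverse x) * \<sigma> x = 1" by (simp flip: mult)
  then show ?thesis by (metis inverse_unique mult.commute)
qed simp

lemma divide [simp]: "\<sigma> (x / y) = \<sigma> x / \<sigma> y"
  by (simp add: divide_inverse)

section \<open>Dimension counts and the order of \<sigma>\<close>

lemma basis_ex:
  obtains B where "finite B" "L.independent B" "L.span B = UNIV" "card B = 3"
proof -
  obtain B where B: "L.independent B" "UNIV \<subseteq> L.span B" "card B = L.dim UNIV"
    by (rule L.basis_exists)
  then have "card B = 3" using degree by (simp add: ext_degree_def)
  \<comment> \<open>Infinite sets have \<open>card\<close> equal to 0, so cardinality 3 already
    forces \<open>B\<close> to be finite.\<close>
  then show thesis using that[of B] B by (metis card.infinite top.extremum_uniqueI zero_neq_numeral)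
qed

lemma independent_card_le_3: "L.independent S \<Longrightarrow> finite S \<and> card S \<le> 3"
  by (rule basis_ex) (metis L.independent_span_bound top_greatest)

lemma four_dependent:
  "\<exists>a b c d. (a \<noteq> 0 \<or> b \<noteq> 0 \<or> c \<noteq> 0 \<or> d \<noteq> 0) \<and>
     \<iota> a * x + \<iota> b * y + \<iota> c * z + \<iota> d * w = 0"
proof (rule ccontr)
  assume "\<not> ?thesis"
  then have "ext_scale \<iota> a x + ext_scale \<iota> b y + ext_scale \<iota> c z + ext_scale \<iota> d w = 0 \<Longrightarrow>
      a = 0 \<and> b = 0 \<and> c = 0 \<and> d = 0" for a b c d
    unfolding ext_scale_def by blast
  note * = L.independent_quadrupleI[OF this]
  show False using independent_card_le_3[OF *(1)] *(2) by simp
qed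

lemma not_two_generated: "\<exists>w. \<forall>a b. w \<noteq> \<iota> a + \<iota> b * z"
proof (rule ccontr)
  assume "\<not> ?thesis"
  then have "UNIV \<subseteq> L.span {1, z}"
    by (auto simp: L.in_span_pair ext_scale_def)
  from L.dim_le_card[OF this] degree show False
    by (simp add: ext_degree_def card_insert_if split: if_splits)
qed

text \<open>Suppose \<sigma> moves z. If \<sigma>^2 is the identity, then 1 and z span L, so the
  degree is at most two. Otherwise \<sigma>^2 moves some w, and 1, z, w, zw are four independent
  elements of a space of dimension three.\<close>

lemma fixed_if_square_fixed:
  assumes "\<sigma> (\<sigma> z) = z"
  shows "\<sigma> z = z"
proof (rule ccontr)
  assume nz: "\<sigma> z \<noteq> z"
  show False
  proof (cases "\<forall>w. \<sigma> (\<sigma> w) = w")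
    case True
    obtain w where w: "\<And>a b. w \<noteq> \<iota> a + \<iota> b * z" using not_two_generated by blast
    \<comment> \<open>Numerator and denominator both change sign under \<sigma>, so t is fixed. It
      is the coefficient of z that makes \<open>w - t * z\<close> fixed too.\<close>
    define t where "t = (w - \<sigma> w) / (z - \<sigma> z)"
    have t: "\<sigma> t = t"
      using True nz unfolding t_def by (simp add: frac_eq_eq algebra_simps)
    have tz: "t * (z - \<sigma> z) = w - \<sigma> w" using nz unfolding t_def by simp
    then have "\<sigma> (w - t * z) = w - t * z" by (simp add: t algebra_simps)
    then obtain a b where "w - t * z = \<iota> a" "t = \<iota> b"
      using fixed_in_base t by blast
    then show False using w[of a b] by (simp add: algebra_simps)
  next
    case False
    then obtain w where w: "\<sigma> (\<sigma> w) \<noteq> w" by blast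
    have indep: "a = 0 \<and> b = 0" if "\<iota> a + \<iota> b * z = 0" for a b
    proof -
      have "\<sigma> (\<iota> a + \<iota> b * z) - (\<iota> a + \<iota> b * z) = \<iota> b * (\<sigma> z - z)" by (simp add: algebra_simps)
      then have "b = 0" using that nz by simp
      then show ?thesis using that by simp
    qed
    obtain a b c d where nonzero: "a \<noteq> 0 \<or> b \<noteq> 0 \<or> c \<noteq> 0 \<or> d \<noteq> 0"
      and rel: "\<iota> a * 1 + \<iota> b * z + \<iota> c * w + \<iota> d * (z * w) = 0"
      using four_dependent[of 1 z w "z * w"] by blast
    have rel': "(\<iota> a + \<iota> b * z) + (\<iota> c + \<iota> d * z) * w = 0" using rel by (simp add: algebra_simps)
    \<comment> \<open>Since \<sigma>^2 fixes z, it fixes both coefficients and changes only w.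
      Subtracting the two relations therefore isolates the coefficient of w.\<close>
    then have "\<sigma> (\<sigma> ((\<iota> a + \<iota> b * z) + (\<iota> c + \<iota> d * z) * w)) = 0" by simp
    then have "(\<iota> a + \<iota> b * z) + (\<iota> c + \<iota> d * z) * \<sigma> (\<sigma> w) = 0" using assms by simp
    with rel' have "(\<iota> c + \<iota> d * z) * (\<sigma> (\<sigma> w) - w) = 0"
      by algebra
    then have "\<iota> c + \<iota> d * z = 0" using w by simp
    then show False using indep[of c d] indep[of a b] rel' nonzero by simp
  qed
qed

lemma cube [simp]: "\<sigma> (\<sigma> (\<sigma> z)) = z"
proof (rule ccontr)
  assume 3: "\<sigma> (\<sigma> (\<sigma> z)) \<noteq> z"
  then have 1: "\<sigma> z \<noteq> z" by auto
  have 2: "\<sigma> (\<sigma> z) \<noteq> z" using 1 fixed_if_square_fixed by blast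
  obtain a b c d where nonzero: "a \<noteq> 0 \<or> b \<noteq> 0 \<or> c \<noteq> 0 \<or> d \<noteq> 0"
    and rel: "\<iota> a * 1 + \<iota> b * z + \<iota> c * (z * z) + \<iota> d * (z * z * z) = 0"
    using four_dependent[of 1 z "z * z" "z * z * z"] by blast
  define p where "p = [:\<iota> a, \<iota> b, \<iota> c, \<iota> d:]"
  have root: "poly p (\<sigma> x) = 0" if "poly p x = 0" for x
  proof -
    have "poly p (\<sigma> x) = \<sigma> (poly p x)" by (simp add: p_def)
    then show ?thesis using that by simp
  qed
  have "poly p z = 0" using rel by (simp add: p_def algebra_simps)
  then have sub: "{z, \<sigma> z, \<sigma> (\<sigma> z), \<sigma> (\<sigma> (\<sigma> z))} \<subseteq> {x. poly p x = 0}"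
    using root by simp
  have p0: "p \<noteq> 0" using nonzero by (auto simp: p_def)
  \<comment> \<open>By injectivity of \<sigma>, every coincidence among the four conjugates reduces
    to z being equal to one of the other three.\<close>
  have "4 = card {z, \<sigma> z, \<sigma> (\<sigma> z), \<sigma> (\<sigma> (\<sigma> z))}"
    using 1 2 3 by (simp add: eq_commute)
  also have "\<dots> \<le> card {x. poly p x = 0}"
    by (rule card_mono[OF poly_roots_finite[OF p0] sub])
  also have "\<dots> \<le> degree p" by (rule card_poly_roots_bound[OF p0])
  also have "\<dots> \<le> 3" by (simp add: p_def)
  finally show False by simp
qed

section \<open>The trace and its kernel\<close>

lemma moved_ex:
  obtains x where "\<sigma> x \<noteq> x"
proof -
  \<comment> \<open>With the generator taken to be 0, the combinations that w avoids are exactly the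
    elements of K.\<close>
  obtain w where w: "\<And>a b. w \<noteq> \<iota> a + \<iota> b * 0" using not_two_generated by blast
  then have "w \<notin> range \<iota>" by auto
  then show thesis using that fixed_in_base by blast
qed

text \<open>Dedekind's argument: if the trace vanished, \<open>\<sigma>\<^sup>2 = - 1 - \<sigma>\<close> would be multiplicative, and comparing
  both sides at \<open>x y\<close> leaves a relation between \<open>y\<close> and \<open>\<sigma> y\<close> only.\<close>

lemma trace_nonzero:
  obtains t where "t + \<sigma> t + \<sigma> (\<sigma> t) \<noteq> 0"
proof (rule ccontr)
  assume "\<not> thesis"
  then have tr: "\<sigma> (\<sigma> t) = - t - \<sigma> t" for t
    using that[of t] by (metis add.commute add_eq_0_iff diff_conv_add_uminus minus_add)
  obtain x where x: "\<sigma> x \<noteq> x" by (rule moved_ex)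
  have rel: "y * (2 * x + \<sigma> x) + \<sigma> y * (2 * \<sigma> x + x) = 0" for y
    using mult[of "\<sigma> x" "\<sigma> y"] tr[of "x * y"] by (simp add: tr algebra_simps)
  \<comment> \<open>The trace of 1 is 3, so only characteristic three remains. There
    \<open>2 * x + \<sigma> x = 0\<close>, obtained next by eliminating between y = x and y = 1,
    says that x is fixed.\<close>
  have "3 = (0::'l)" using tr[of 1] by (simp add: algebra_simps)
  have "(x - \<sigma> x) * (2 * x + \<sigma> x) = 0"
    using rel[of x] rel[of 1] by simp algebra
  then have "2 * x + \<sigma> x = 0" using x by simp
  then have "\<sigma> x - x = - (3 * x)" by (simp add: eq_neg_iff_add_eq_0 algebra_simps)
  then show False using x \<open>3 = 0\<close> by simp
qed

text \<open>Differences \<open>\<sigma> x - x\<close> have trace zero because the sum telescopes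
  once \<sigma>^3 = 1. For the converse an element t of nonzero trace replaces division by 3, so
  that characteristic three is covered.\<close>

lemma trace_zero_iff: "b + \<sigma> b + \<sigma> (\<sigma> b) = 0 \<longleftrightarrow> b \<in> range (\<lambda>x. \<sigma> x - x)"
proof
  assume b: "b + \<sigma> b + \<sigma> (\<sigma> b) = 0"
  obtain t where t: "t + \<sigma> t + \<sigma> (\<sigma> t) \<noteq> 0" by (rule trace_nonzero)
  define s where "s = t + \<sigma> t + \<sigma> (\<sigma> t)"
  have s: "\<sigma> s = s" "s \<noteq> 0" using t by (simp_all add: s_def algebra_simps)
  \<comment> \<open>The conjugates of t are weighted by the partial sums of the trace of b. The last
    partial sum vanishes, so \<open>\<sigma> y - y\<close> collapses to \<open>- (b * s)\<close>,
    and s is fixed and can be divided out.\<close>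
  define y where "y = b * \<sigma> t + (b + \<sigma> b) * \<sigma> (\<sigma> t)"
  have b2: "\<sigma> (\<sigma> b) = - b - \<sigma> b" using b by (simp add: eq_neg_iff_add_eq_0 algebra_simps)
  have "\<sigma> y - y = - (b * s)" by (simp add: y_def s_def b2 algebra_simps)
  then have "b = \<sigma> (- (y / s)) - (- (y / s))" using s by (simp add: field_simps)
  then show "b \<in> range (\<lambda>x. \<sigma> x - x)" by (rule image_eqI) simp
qed auto

text \<open>The kernel of \<sigma> - 1 is K, so extending 1 to a basis 1, p, q of L makes the images
  of p and q a basis of the range. Explicit coefficients allow u and v to be used both as vectors of
  L and as multiplication operators.\<close>

lemma trace_kernel_basis:
  obtains u v where
    "\<forall>a b. \<iota> a * u + \<iota> b * v = 0 \<longrightarrow> a = 0 \<and> b = 0"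
    "range (\<lambda>x. \<sigma> x - x) = {\<iota> a * u + \<iota> b * v |a b. True}"
proof -
  obtain B where B: "1 \<in> B" "L.independent B" "L.span B = UNIV"
  proof -
    have "L.independent {1}" by simp
    then show thesis
      using that L.independent_extend_basis[of "{1}"] L.span_extend_basis[of "{1}"]
        L.extend_basis_superset[of "{1}"] by blast
  qed
  have "card B = 3" using L.dim_eq_card[of B UNIV] B degree by (simp add: ext_degree_def)
  then have "card (B - {1}) = 2" using B(1) by simp
  then obtain p q where pq: "B - {1} = {p, q}" "p \<noteq> q" by (meson card_2_iff)
  then have Beq: "B = {1, p, q}" and ne: "p \<noteq> 1" "q \<noteq> 1" using B(1) by auto
  have span: "\<exists>a b c. z = \<iota> a + \<iota> b * p + \<iota> c * q" for z
    using B(3) L.in_span_triple[of z 1 p q] by (simp add: Beq ext_scale_def)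
  have notin: "q \<notin> L.span {1, p}" "p \<notin> L.span {1}"
    using B(2) ne pq(2) L.independent_insert[of q "{1, p}"] L.independent_insert[of p "{1}"]
    by (auto simp: Beq insert_commute)
  have indep: "b = 0 \<and> c = 0" if rel: "\<iota> a + \<iota> b * p + \<iota> c * q = 0" for a b c
  proof -
    have "c = 0"
    proof (rule ccontr)
      assume c: "c \<noteq> 0"
      have "\<iota> c * \<iota> (1 / c) = 1" using c by (simp add: emb_one flip: emb_mult)
      then have "q = \<iota> (- a * (1 / c)) * 1 + \<iota> (- b * (1 / c)) * p"
        unfolding emb_mult emb_minus using rel by algebra
      then show False using notin(1) by (auto simp: L.in_span_pair ext_scale_def)
    qed
    moreover have "b = 0"
    proof (rule ccontr)
      assume b: "b \<noteq> 0"
      have "\<iota> b * \<iota> (1 / b) = 1" using b by (simp add: emb_one flip: emb_mult)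
      moreover have "\<iota> a + \<iota> b * p = 0" using rel \<open>c = 0\<close> by simp
      ultimately have "p = \<iota> (- a * (1 / b)) * 1"
        unfolding emb_mult emb_minus by algebra
      then show False using notin(2) by (auto simp: L.span_singleton ext_scale_def)
    qed
    ultimately show ?thesis by simp
  qed
  show thesis
  proof (rule that[of "\<sigma> p - p" "\<sigma> q - q"])
    have "a = 0 \<and> b = 0" if "\<iota> a * (\<sigma> p - p) + \<iota> b * (\<sigma> q - q) = 0" for a b
    proof -
      from that have "\<sigma> (\<iota> a * p + \<iota> b * q) = \<iota> a * p + \<iota> b * q"
        by (simp add: algebra_simps)
      \<comment> \<open>A fixed combination of p and q lies in K, which gives a linear relation
        among 1, p and q.\<close>
      then obtain c where "\<iota> a * p + \<iota> b * q = \<iota> c" using fixed_in_base by blast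
      then have "\<iota> (- c) + \<iota> a * p + \<iota> b * q = 0" by (simp add: emb_minus algebra_simps)
      then show ?thesis by (rule indep)
    qed
    then show "\<forall>a b. \<iota> a * (\<sigma> p - p) + \<iota> b * (\<sigma> q - q) = 0 \<longrightarrow> a = 0 \<and> b = 0" by blast
  next
    have "\<sigma> z - z \<in> {\<iota> a * (\<sigma> p - p) + \<iota> b * (\<sigma> q - q) |a b. True}" for z
    proof -
      obtain a b c where "z = \<iota> a + \<iota> b * p + \<iota> c * q" using span by blast
      then have "\<sigma> z - z = \<iota> b * (\<sigma> p - p) + \<iota> c * (\<sigma> q - q)" by (simp add: algebra_simps)
      then show ?thesis by blast
    qed
    moreover have "\<iota> a * (\<sigma> p - p) + \<iota> b * (\<sigma> q - q) \<in> range (\<lambda>x. \<sigma> x - x)" for a b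
      by (rule image_eqI[of _ _ "\<iota> a * p + \<iota> b * q"]) (simp_all add: algebra_simps)
    ultimately show "range (\<lambda>x. \<sigma> x - x) = {\<iota> a * (\<sigma> p - p) + \<iota> b * (\<sigma> q - q) |a b. True}"
      by blast
  qed
qed

lemma dim_trace_kernel: "L.dim (range (\<lambda>x. \<sigma> x - x)) = 2"
proof -
  obtain u v where uv: "\<forall>a b. \<iota> a * u + \<iota> b * v = 0 \<longrightarrow> a = 0 \<and> b = 0"
    "range (\<lambda>x. \<sigma> x - x) = {\<iota> a * u + \<iota> b * v |a b. True}"
    by (rule trace_kernel_basis)
  have "range (\<lambda>x. \<sigma> x - x) = L.span {u, v}"
    unfolding uv(2) set_eq_iff L.in_span_pair ext_scale_def by blast
  moreover have "L.independent {u, v}" "u \<noteq> v"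
    using L.independent_pairI[of u v] uv(1) by (auto simp: ext_scale_def)
  ultimately show ?thesis by (simp add: L.dim_eq_card_independent)
qed

section \<open>The space \<open>N_space\<close> and its dimension\<close>

definition D :: "'l \<Rightarrow> 'l"
  where "D = (\<lambda>z. \<sigma> (\<sigma> z) - \<sigma> z)"

lemma D_nonzero: "D \<noteq> 0"
proof -
  obtain x where "\<sigma> x \<noteq> x" by (rule moved_ex)
  then have "D x \<noteq> 0" by (simp add: D_def)
  then show ?thesis by auto
qed

lemma T_map_eq: "T_map \<iota> \<sigma> a b = (\<lambda>z. \<iota> a * D z + b * z)"
  by (simp add: T_map_def D_def ext_scale_def numeral_2_eq_2)

lemma N_space_eq: "N_space \<iota> \<sigma> = {\<lambda>z. \<iota> a * D z + b * z |a b. b \<in> range (\<lambda>x. \<sigma> x - x)}"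
  by (simp add: N_space_def T_map_eq numeral_2_eq_2 flip: trace_zero_iff)

lemma N_space_endomorphisms: "N_space \<iota> \<sigma> \<subseteq> endomorphisms \<iota>"
proof -
  have "Vector_Spaces.linear (ext_scale \<iota>) (ext_scale \<iota>) (\<lambda>z. \<iota> a * D z + b * z)" for a b
    by unfold_locales (simp_all add: D_def ext_scale_def algebra_simps)
  then show ?thesis unfolding N_space_eq endomorphisms_def by blast
qed

text \<open>A basis consists of \<open>D\<close> and the multiplications by the two basis elements
  of the trace kernel.\<close>

lemma N_space_subspace_dim: "F.subspace (N_space \<iota> \<sigma>) \<and> F.dim (N_space \<iota> \<sigma>) = 3"
proof -
  obtain u v where uv: "\<forall>a b. \<iota> a * u + \<iota> b * v = 0 \<longrightarrow> a = 0 \<and> b = 0"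
    "range (\<lambda>x. \<sigma> x - x) = {\<iota> a * u + \<iota> b * v |a b. True}"
    by (rule trace_kernel_basis)
  have combination: "map_scale \<iota> a D + map_scale \<iota> b ((*) u) + map_scale \<iota> c ((*) v)
      = (\<lambda>z. \<iota> a * D z + (\<iota> b * u + \<iota> c * v) * z)" for a b c
    by (simp add: map_scale_def ext_scale_def fun_eq_iff algebra_simps)
  have span: "N_space \<iota> \<sigma> = F.span {D, (*) u, (*) v}"
    unfolding N_space_eq uv(2) set_eq_iff F.in_span_triple combination by blast
  have "a = 0 \<and> b = 0 \<and> c = 0"
    if "map_scale \<iota> a D + map_scale \<iota> b ((*) u) + map_scale \<iota> c ((*) v) = 0" for a b c
  proof -
    have rel: "\<iota> a * D z + (\<iota> b * u + \<iota> c * v) * z = 0" for z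
      using fun_cong[OF that[unfolded combination], of z] by simp
    \<comment> \<open>\<open>D\<close> kills 1, so evaluation at 1 leaves only the multiplication
      part.\<close>
    have "\<iota> b * u + \<iota> c * v = 0" using rel[of 1] by (simp add: D_def)
    moreover have "a = 0"
      using rel D_nonzero \<open>\<iota> b * u + \<iota> c * v = 0\<close> by (auto simp: fun_eq_iff)
    ultimately show ?thesis using uv(1) by blast
  qed
  note F.independent_tripleI[of D "(*) u" "(*) v", OF this]
  then show ?thesis unfolding span by (simp add: F.dim_eq_card_independent)
qed

section \<open>Invertible and singular elements\<close>

lemma trace_zero_quotient:
  assumes "a \<noteq> 0" "z \<noteq> 0" "\<iota> a * D z + b * z = 0" "b + \<sigma> b + \<sigma> (\<sigma> b) = 0"
  shows "\<sigma> z = z"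
proof -
  define r where "r = \<sigma> z"
  define s where "s = \<sigma> r"
  have conj: "\<sigma> z = r" "\<sigma> r = s" "\<sigma> s = z" by (simp_all add: r_def s_def)
  have 0: "\<iota> a * (s - r) + b * z = 0" using assms(3) by (simp add: D_def conj)
  have 1: "\<iota> a * (z - s) + \<sigma> b * r = 0" using arg_cong[OF 0, of \<sigma>] by (simp add: conj)
  have 2: "\<iota> a * (r - z) + \<sigma> (\<sigma> b) * s = 0" using arg_cong[OF 1, of \<sigma>] by (simp add: conj)
  have "\<iota> a * ((r - z) * (s - r) * (z - s)) = 0"
  proof -
    \<comment> \<open>The three conjugate equations are multiplied by rs, zs and zr, which gives the
      conjugates of b the common factor zrs. Their sum is the trace of b times zrs, minus
      \<open>\<iota> a\<close> times the Vandermonde product.\<close>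
    have "\<iota> a * ((r - z) * (s - r) * (z - s)) =
        (b + \<sigma> b + \<sigma> (\<sigma> b)) * (z * r * s) - (\<iota> a * (s - r) + b * z) * (r * s)
        - (\<iota> a * (z - s) + \<sigma> b * r) * (z * s) - (\<iota> a * (r - z) + \<sigma> (\<sigma> b) * s) * (z * r)"
      by (simp add: algebra_simps)
    then show ?thesis by (simp add: 0 1 2 assms(4))
  qed
  then have "r = z \<or> s = r \<or> z = s" using assms(1) by auto
  then show ?thesis
    using fixed_if_square_fixed[of z] by (auto simp: r_def s_def)
qed

lemma inj_imp_invertible:
  assumes "f \<in> endomorphisms \<iota>" "inj f"
  shows "invertible_endo \<iota> f"
proof -
  obtain B where B: "finite B" "L.independent B" "L.span B = UNIV"
    using basis_ex by metis
  interpret finite_dimensional_vector_space "ext_scale \<iota>" B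
    by unfold_locales (use B in auto)
  interpret finite_dimensional_vector_space_pair "ext_scale \<iota>" B "ext_scale \<iota>" B ..
  show ?thesis
    using linear_injective_isomorphism[of f] assms
    by (auto simp: invertible_endo_def endomorphisms_def fun_eq_iff)
qed

lemma T_invertible:
  assumes b: "b \<in> range (\<lambda>x. \<sigma> x - x)" "b \<noteq> 0"
  shows "invertible_endo \<iota> (\<lambda>z. \<iota> a * D z + b * z)"
proof (rule inj_imp_invertible)
  show "(\<lambda>z. \<iota> a * D z + b * z) \<in> endomorphisms \<iota>"
    using N_space_endomorphisms b(1) unfolding N_space_eq by blast
  have kernel: "z = 0" if "\<iota> a * D z + b * z = 0" for z
  proof (rule ccontr)
    assume "z \<noteq> 0"
    then have "a \<noteq> 0" using that b(2) by auto
    with \<open>z \<noteq> 0\<close> have "\<sigma> z = z"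
      using trace_zero_quotient that b(1) by (simp add: trace_zero_iff)
    \<comment> \<open>\<open>D\<close> vanishes on fixed elements, so the equation reduces to
      \<open>b * z = 0\<close>.\<close>
    then show False using that \<open>z \<noteq> 0\<close> b(2) by (simp add: D_def)
  qed
  show "inj (\<lambda>z. \<iota> a * D z + b * z)"
  proof (rule injI)
    fix x y assume "\<iota> a * D x + b * x = \<iota> a * D y + b * y"
    then have "\<iota> a * D (x - y) + b * (x - y) = 0" by (simp add: D_def algebra_simps)
    then have "x - y = 0" by (rule kernel)
    then show "x = y" by simp
  qed
qed

lemma scaled_D_not_invertible: "\<not> invertible_endo \<iota> (map_scale \<iota> c D)"
proof
  assume "invertible_endo \<iota> (map_scale \<iota> c D)"
  then obtain g where "g \<circ> map_scale \<iota> c D = id" by (auto simp: invertible_endo_def)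
  \<comment> \<open>Both 1 and 0 are mapped to 0, so a left inverse would have to send 0 to
    both.\<close>
  then have "g (map_scale \<iota> c D 1) = 1" "g (map_scale \<iota> c D 0) = 0"
    by (metis comp_apply id_apply)+
  then show False by (simp add: map_scale_def ext_scale_def D_def)
qed

lemma N_singular_eq: "N_singular \<iota> \<sigma> = {map_scale \<iota> c D |c. True}"
proof -
  have D: "map_scale \<iota> c D = (\<lambda>z. \<iota> c * D z + 0 * z)" for c
    by (simp add: map_scale_def ext_scale_def)
  have "0 \<in> range (\<lambda>x. \<sigma> x - x)" by (rule image_eqI[of _ _ 0]) auto
  then have "map_scale \<iota> c D \<in> N_singular \<iota> \<sigma>" for c
    using scaled_D_not_invertible unfolding N_singular_def N_space_eq D by blast
  moreover have "f \<in> {map_scale \<iota> c D |c. True}" if f_in: "f \<in> N_singular \<iota> \<sigma>" for f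
  proof -
    obtain a b where f: "f = (\<lambda>z. \<iota> a * D z + b * z)" and b: "b \<in> range (\<lambda>x. \<sigma> x - x)"
      using f_in unfolding N_singular_def N_space_eq by blast
    moreover have "\<not> invertible_endo \<iota> f" using f_in by (simp add: N_singular_def)
    ultimately have "b = 0" using T_invertible by blast
    then have "f = map_scale \<iota> a D" by (simp add: f D)
    then show ?thesis by blast
  qed
  ultimately show ?thesis by blast
qed

lemma N_singular_subspace_dim: "F.subspace (N_singular \<iota> \<sigma>) \<and> F.dim (N_singular \<iota> \<sigma>) = 1"
proof -
  have "N_singular \<iota> \<sigma> = F.span {D}"
    unfolding N_singular_eq F.span_singleton by auto
  moreover have "F.independent {D}" using D_nonzero by simp
  ultimately show ?thesis by (simp add: F.dim_eq_card_independent)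
qed

text \<open>\<open>D\<close> is \<sigma> - 1 composed with the bijection \<sigma>, and a nonzero
  scalar does not change a range. The rank is therefore the dimension of the trace kernel.\<close>

lemma rank_scaled_D:
  assumes "map_scale \<iota> c D \<noteq> 0"
  shows "endo_rank \<iota> (map_scale \<iota> c D) = 2"
proof -
  have c: "c \<noteq> 0" using assms by auto
  have "map_scale \<iota> c D z \<in> range (\<lambda>x. \<sigma> x - x)" for z
    by (rule image_eqI[of _ _ "\<iota> c * \<sigma> z"])
      (simp_all add: map_scale_def ext_scale_def D_def algebra_simps)
  moreover have "\<sigma> z - z \<in> range (map_scale \<iota> c D)" for z
    \<comment> \<open>As \<sigma>^3 = 1, applying \<sigma>^2 to z undoes the extra \<sigma>
      contained in \<open>D\<close>.\<close>
    by (rule image_eqI[of _ _ "\<sigma> (\<sigma> z) / \<iota> c"])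
      (use c in \<open>simp_all add: map_scale_def ext_scale_def D_def field_simps\<close>)
  ultimately have "range (map_scale \<iota> c D) = range (\<lambda>z. \<sigma> z - z)"
    by blast
  then show ?thesis by (simp add: endo_rank_def dim_trace_kernel)
qed

end

section \<open>From the Galois hypotheses to the cubic setting\<close>

lemma cyclic_cubicI:
  assumes galois: "galois_extension \<iota>" and "ext_degree \<iota> = 3"
    and \<sigma>: "\<sigma> \<in> carrier (galois_group \<iota>)"
    and gen: "carrier (galois_group \<iota>) = generate (galois_group \<iota>) {\<sigma>}"
  shows "cyclic_cubic \<iota> \<sigma>"
proof -
  interpret group "galois_group \<iota>" by (rule group_galois_group)
  interpret field_extension \<iota> using galois by (simp add: galois_extension_def)
  have "z \<in> range \<iota>" if z: "\<sigma> z = z" for z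
  proof -
    \<comment> \<open>Being fixed by the generator passes to products and inverses, hence to the
      whole group, and Artin's condition then places z in K.\<close>
    have "\<tau> z = z" if "\<tau> \<in> generate (galois_group \<iota>) {\<sigma>}" for \<tau>
      using that
    proof induction
      case one
      then show ?case by (simp add: galois_group_def)
    next
      case (incl h)
      then show ?case using z by simp
    next
      case (inv h)
      then have "(inv\<^bsub>galois_group \<iota>\<^esub> \<sigma> \<circ> \<sigma>) z = z"
        using l_inv[OF \<sigma>] by (simp add: galois_group_def)
      then show ?case using inv z by simp
    next
      case (eng h1 h2)
      then show ?case by (simp add: galois_group_def)
    qed
    then have "z \<in> {z. \<forall>\<tau>\<in>carrier (galois_group \<iota>). \<tau> z = z}" unfolding gen by blast
    then show ?thesis using galois unfolding galois_extension_def by blast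
  qed
  then show ?thesis
    using \<sigma> assms(2) by unfold_locales (auto simp: galois_group_def)
qed

theorem theorem7:
  fixes \<iota> :: "'k::field \<Rightarrow> 'l::field" and \<sigma> :: "'l \<Rightarrow> 'l"
  assumes "galois_extension \<iota>"
    and "ext_degree \<iota> = 3"
    and "\<sigma> \<in> carrier (galois_group \<iota>)"
    and "carrier (galois_group \<iota>) = generate (galois_group \<iota>) {\<sigma>}"
  shows "N_space \<iota> \<sigma> \<subseteq> endomorphisms \<iota>
    \<and> module.subspace (map_scale \<iota>) (N_space \<iota> \<sigma>)
    \<and> vector_space.dim (map_scale \<iota>) (N_space \<iota> \<sigma>) = 3
    \<and> N_singular \<iota> \<sigma> = {map_scale \<iota> c (\<lambda>z. (\<sigma> ^^ 2) z - \<sigma> z) |c. True}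
    \<and> module.subspace (map_scale \<iota>) (N_singular \<iota> \<sigma>)
    \<and> vector_space.dim (map_scale \<iota>) (N_singular \<iota> \<sigma>) = 1
    \<and> (\<forall>f \<in> N_singular \<iota> \<sigma>. f \<noteq> 0 \<longrightarrow> endo_rank \<iota> f = 2)"
proof -
  interpret cyclic_cubic \<iota> \<sigma> by (rule cyclic_cubicI[OF assms])
  have D: "(\<lambda>z. (\<sigma> ^^ 2) z - \<sigma> z) = D" by (simp add: D_def numeral_2_eq_2)
  have "\<forall>f \<in> N_singular \<iota> \<sigma>. f \<noteq> 0 \<longrightarrow> endo_rank \<iota> f = 2"
    unfolding N_singular_eq using rank_scaled_D by blast
  then show ?thesis
    using N_space_endomorphisms N_space_subspace_dim N_singular_subspace_dim N_singular_eq
    unfolding D by blast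
qed

end
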